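(* Let $\mathcal{K}\subseteq\mathbb{R}^d$ be a convex cone, let $f:\mathcal{K}\to\mathbb{R}$ be differentiable, strictly convex, with $L$-Lipschitz continuous gradient, and let $\mathbf{x}^*\neq\mathbf{0}$ be an optimal solution of $\min_{\mathbf{x}\in\mathcal{K}}f(\mathbf{x})$. Let $(\mathbf{x}_k),(\eta_k)$ be generated by MOCO with $\delta_k=\frac{2}{k+2}$ from $\mathbf{x}_0\in\mathcal{K}$. Then for every $k\ge 0$, $$f(\eta_{k+1}\mathbf{x}_{k+1})-f(\mathbf{x}^* )\ \le\ \frac{2L\|\mathbf{x}^*\|^2}{k+2}-\rho_k ,$$ where $\rho_k\ge 0$ is as defined in the context.
   Context: Here $\|\cdot\|$ is a norm on $\mathbb{R}^d$ with dual norm $\|\cdot\|_*$. A convex cone $\mathcal{K}$ satisfies $\lambda_1\mathbf{x}+\lambda_2\mathbf{y}\in\mathcal{K}$ for all $\lambda_1,\lambda_2\ge 0$ and $\mathbf{x},\mathbf{y}\in\mathcal{K}$. $L$-Lipschitz gradient means $\|\nabla f(\mathbf{x})-\nabla f(\mathbf{y})\|_*\le L\|\mathbf{x}-\mathbf{y}\|$ for all $\mathbf{x},\mathbf{y}\in\mathcal{K}$. Strict convexity means $f(\mathbf{y})-f(\mathbf{x})>\langle\nabla f(\mathbf{x}),\mathbf{y}-\mathbf{x}\rangle$ for all $\mathbf{x}\ne\mathbf{y}$ in $\mathcal{K}$. MOCO (momentum conic descent): given $\mathbf{x}_0\in\mathcal{K}$ and $\delta_k=\frac{2}{k+2}$,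 for $k=0,1,\dots$ (each argmin denotes a chosen minimizer, assumed to be attained): (1) $\eta_k\in\arg\min_{\eta\ge 0}f(\eta\mathbf{x}_k)$; (2) $\mathbf{g}_k=(1-\delta_k)\mathbf{g}_{k-1}+\delta_k\nabla f(\eta_k\mathbf{x}_k)$ (since $\delta_0=1$, $\mathbf{g}_{-1}$ is irrelevant); (3) $\mathbf{v}_k\in\arg\min\{\langle\mathbf{g}_k,\mathbf{v}\rangle:\ \mathbf{v}\in\mathcal{K},\ \|\mathbf{v}\|\le 1\}$; (4) $\theta_k\in\arg\min_{\theta\ge 0}f(\eta_k\mathbf{x}_k+\theta\mathbf{v}_k)$; (5) $\mathbf{x}_{k+1}=\eta_k\mathbf{x}_k+\theta_k\mathbf{v}_k$. The quantity $\rho_k$ is the weighted average $$\rho_k=\sum_{\tau=0}^k\frac{2(\tau+1)}{(k+1)(k+2)}\,\xi_\tau(\mathbf{x}^* ),\qquad \xi_\tau(\mathbf{x})=f(\mathbf{x})-f(\eta_\tau\mathbf{x}_\tau)-\langle\nabla f(\eta_\tau\mathbf{x}_\tau),\mathbf{x}-\eta_\tau\mathbf{x}_\tau\rangle .$$ *)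

theory Defs
  imports "HOL-Analysis.Analysis"
begin

text \<open>
  An arbitrary norm on a real vector space, in general different from the Euclidean
  \<open>norm\<close> of the type.
\<close>

definition is_norm :: "('a::real_vector \<Rightarrow> real) \<Rightarrow> bool" where
  "is_norm N \<longleftrightarrow>
     (\<forall>x. 0 \<le> N x) \<and>
     (\<forall>x. N x = 0 \<longleftrightarrow> x = 0) \<and>
     (\<forall>a x. N (a *\<^sub>R x) = \<bar>a\<bar> * N x) \<and>
     (\<forall>x y. N (x + y) \<le> N x + N y)"

text \<open>
  In finite dimension the supremum below ranges over a nonempty set that is bounded above,
  so it is a genuine supremum whenever \<open>is_norm N\<close> holds.
\<close>

definition dual_norm :: "('a::euclidean_space \<Rightarrow> real) \<Rightarrow> 'a \<Rightarrow> real" where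
  "dual_norm N z = (SUP x\<in>{x. N x \<le> 1}. z \<bullet> x)"

text \<open>
  The derivative is taken within \<open>K\<close>, so only the values of \<open>f\<close> on \<open>K\<close> matter and no
  extension of \<open>f\<close> beyond \<open>K\<close> is needed. If \<open>K\<close> has empty interior, \<open>G\<close> is not
  determined by \<open>f\<close>; it is then any choice of gradient.
\<close>

definition has_gradient_on ::
    "('a::euclidean_space \<Rightarrow> real) \<Rightarrow> ('a \<Rightarrow> 'a) \<Rightarrow> 'a set \<Rightarrow> bool" where
  "has_gradient_on f G K \<longleftrightarrow>
     (\<forall>x\<in>K. (f has_derivative (\<lambda>h. G x \<bullet> h)) (at x within K))"

definition strictly_convex_grad ::
    "('a::euclidean_space \<Rightarrow> real) \<Rightarrow> ('a \<Rightarrow> 'a) \<Rightarrow> 'a set \<Rightarrow> bool" where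
  "strictly_convex_grad f G K \<longleftrightarrow>
     (\<forall>x\<in>K. \<forall>y\<in>K. x \<noteq> y \<longrightarrow> f y - f x > G x \<bullet> (y - x))"

definition lipschitz_gradient ::
    "('a::euclidean_space \<Rightarrow> real) \<Rightarrow> real \<Rightarrow> ('a \<Rightarrow> 'a) \<Rightarrow> 'a set \<Rightarrow> bool" where
  "lipschitz_gradient N L G K \<longleftrightarrow>
     (\<forall>x\<in>K. \<forall>y\<in>K. dual_norm N (G x - G y) \<le> L * N (x - y))"

text \<open>
  Runs of momentum conic descent, with step sizes \<open>\<delta>\<close>. Minimizers need not be unique (nor
  exist), hence a relation: \<open>\<eta>\<close>, \<open>v\<close>, \<open>\<theta>\<close> are any selections of minimizers.
  The vector \<open>g0\<close> is the initial momentum, that is, \<open>g\<close> at index \<open>-1\<close>.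
\<close>

definition moco ::
    "('a::euclidean_space \<Rightarrow> real) \<Rightarrow> 'a set \<Rightarrow> ('a \<Rightarrow> real) \<Rightarrow> ('a \<Rightarrow> 'a) \<Rightarrow> (nat \<Rightarrow> real) \<Rightarrow> 'a \<Rightarrow>
     (nat \<Rightarrow> 'a) \<Rightarrow> (nat \<Rightarrow> real) \<Rightarrow> (nat \<Rightarrow> 'a) \<Rightarrow> (nat \<Rightarrow> 'a) \<Rightarrow> (nat \<Rightarrow> real) \<Rightarrow> bool" where
  "moco N K f G \<delta> g0 x \<eta> g v \<theta> \<longleftrightarrow>
     x 0 \<in> K \<and>
     (\<forall>k. is_arg_min (\<lambda>e. f (e *\<^sub>R x k)) (\<lambda>e. 0 \<le> e) (\<eta> k) \<and>
          g k = (1 - \<delta> k) *\<^sub>R (case k of 0 \<Rightarrow> g0 | Suc j \<Rightarrow> g j) + \<delta> k *\<^sub>R G (\<eta> k *\<^sub>R x k) \<and>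
          is_arg_min (\<lambda>w. g k \<bullet> w) (\<lambda>w. w \<in> K \<and> N w \<le> 1) (v k) \<and>
          is_arg_min (\<lambda>t. f (\<eta> k *\<^sub>R x k + t *\<^sub>R v k)) (\<lambda>t. 0 \<le> t) (\<theta> k) \<and>
          x (Suc k) = \<eta> k *\<^sub>R x k + \<theta> k *\<^sub>R v k)"

definition bregman_gap ::
    "('a::euclidean_space \<Rightarrow> real) \<Rightarrow> ('a \<Rightarrow> 'a) \<Rightarrow> (nat \<Rightarrow> 'a) \<Rightarrow> (nat \<Rightarrow> real) \<Rightarrow> nat \<Rightarrow> 'a \<Rightarrow> real" where
  "bregman_gap f G x \<eta> \<tau> y =
     f y - f (\<eta> \<tau> *\<^sub>R x \<tau>) - G (\<eta> \<tau> *\<^sub>R x \<tau>) \<bullet> (y - \<eta> \<tau> *\<^sub>R x \<tau>)"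

definition moco_rho ::
    "('a::euclidean_space \<Rightarrow> real) \<Rightarrow> ('a \<Rightarrow> 'a) \<Rightarrow> (nat \<Rightarrow> 'a) \<Rightarrow> (nat \<Rightarrow> real) \<Rightarrow> 'a \<Rightarrow> nat \<Rightarrow> real" where
  "moco_rho f G x \<eta> xs k =
     (\<Sum>\<tau>=0..k. 2 * (real \<tau> + 1) / ((real k + 1) * (real k + 2)) * bregman_gap f G x \<eta> \<tau> xs)"

end

theory Submission
  imports Defs
begin

text \<open>
  Write \<open>y\<^sub>k = \<eta>\<^sub>k x\<^sub>k\<close> and \<open>R = N xs\<close>. The momentum turns the method into an estimate-sequence scheme:
  \<open>g\<^sub>k\<close> is the slope of the weighted average
  \<open>\<Phi>\<^sub>k(z) = (\<Sum>\<tau>\<le>k. 2(\<tau>+1) / ((k+1)(k+2)) * (f(y\<^sub>\<tau>) + G(y\<^sub>\<tau>) \<bullet> (z - y\<^sub>\<tau>)))\<close>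
  of the tangent planes met so far. By convexity \<open>\<Phi>\<^sub>k\<close> lies below \<open>f\<close> on the cone, and its deficit at
  \<open>xs\<close> is exactly \<open>\<rho>\<^sub>k\<close>, so it suffices to compare \<open>f(y\<^sub>k\<^sub>+\<^sub>1)\<close> with \<open>\<Phi>\<^sub>k(xs)\<close>.

  Two features of the cone make this comparison work without any bound on the iterates.
  Since \<open>\<eta>\<^sub>k\<close> is optimal on the ray through \<open>x\<^sub>k\<close>, the gradient at \<open>y\<^sub>k\<close> is orthogonal to \<open>y\<^sub>k\<close>
  (\<open>gradient_orthogonal_at_ray_minimizer\<close>); hence the linear part of \<open>\<Phi>\<^sub>k\<close> is just
  \<open>z \<mapsto> g\<^sub>k \<bullet> z\<close>, and \<open>R v\<^sub>k\<close> minimizes \<open>\<Phi>\<^sub>k\<close> over the part of the cone inside the ball of radius \<open>R\<close>,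
  which contains \<open>xs\<close>. Moreover the line search may move along \<open>v\<^sub>k\<close> without shrinking \<open>y\<^sub>k\<close>, so
  the descent lemma with step \<open>t = \<delta>\<^sub>k R\<close> leaves only the quadratic error \<open>L t\<^sup>2 / 2\<close>
  (\<open>moco_progress\<close>).

  Let \<open>m\<^sub>k = \<Phi>\<^sub>k(R v\<^sub>k)\<close>. Optimality of \<open>v\<^sub>k\<^sub>-\<^sub>1\<close> for \<open>g\<^sub>k\<^sub>-\<^sub>1\<close> gives
  \<open>f(y\<^sub>k\<^sub>+\<^sub>1) - m\<^sub>k \<le> (1 - \<delta>\<^sub>k) (f(y\<^sub>k) - m\<^sub>k\<^sub>-\<^sub>1) + L \<delta>\<^sub>k\<^sup>2 R\<^sup>2 / 2\<close>.
  Multiplied by \<open>(k+1)(k+2)\<close>, with \<open>\<delta>\<^sub>k = 2/(k+2)\<close>, this recursion telescopes: every step adds at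
  most \<open>2 L R\<^sup>2\<close>, and \<open>k + 1\<close> such terms divided by \<open>(k+1)(k+2)\<close> give the rate
  (\<open>moco_estimate\<close>).
\<close>

section \<open>Norms and dual norms\<close>

lemma
  assumes "is_norm N"
  shows is_norm_nonneg: "0 \<le> N x"
    and is_norm_zero: "N 0 = 0"
    and is_norm_pos: "x \<noteq> 0 \<Longrightarrow> 0 < N x"
    and is_norm_scaleR: "N (a *\<^sub>R x) = \<bar>a\<bar> * N x"
    and is_norm_triangle: "N (x + y) \<le> N x + N y"
  using assms unfolding is_norm_def by (auto simp: less_le)

lemma is_norm_convex_on:
  assumes "is_norm N"
  shows "convex_on UNIV N"
proof (rule convex_onI)
  fix t :: real and x y
  assume t: "0 < t" "t < 1"
  have "N ((1 - t) *\<^sub>R x + t *\<^sub>R y) \<le> N ((1 - t) *\<^sub>R x) + N (t *\<^sub>R y)"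
    by (rule is_norm_triangle[OF assms])
  also have "\<dots> = (1 - t) * N x + t * N y"
    using t by (simp add: is_norm_scaleR[OF assms])
  finally show "N ((1 - t) *\<^sub>R x + t *\<^sub>R y) \<le> (1 - t) * N x + t * N y" .
qed simp

text \<open>
  On a finite-dimensional space a norm is a convex function, hence continuous, so it has a
  positive minimum on the Euclidean unit sphere. This is what makes the unit ball of \<open>N\<close>
  bounded and the supremum in the dual norm a genuine one.
\<close>

lemma is_norm_ge_norm:
  fixes N :: "'a::euclidean_space \<Rightarrow> real"
  assumes N: "is_norm N"
  obtains m where "0 < m" "\<And>x. m * norm x \<le> N x"
proof -
  have "continuous_on (sphere 0 1) N"
    using convex_on_continuous[OF open_UNIV is_norm_convex_on[OF N]]
    by (rule continuous_on_subset) simp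
  then obtain u where u: "norm u = 1" and min: "\<And>x. norm x = 1 \<Longrightarrow> N u \<le> N x"
    using continuous_attains_inf[of "sphere (0::'a) 1" N] by auto
  show thesis
  proof
    show "0 < N u"
      using u by (intro is_norm_pos[OF N]) auto
    show "N u * norm x \<le> N x" for x
    proof (cases "x = 0")
      case True
      then show ?thesis by (simp add: is_norm_zero[OF N])
    next
      case False
      have "N u \<le> N (inverse (norm x) *\<^sub>R x)"
        using False by (intro min) simp
      also have "\<dots> = inverse (norm x) * N x"
        by (simp add: is_norm_scaleR[OF N])
      finally show ?thesis
        using False by (simp add: field_simps)
    qed
  qed
qed

lemma dual_norm_upper:
  fixes N :: "'a::euclidean_space \<Rightarrow> real"
  assumes N: "is_norm N" and "N w \<le> 1"
  shows "z \<bullet> w \<le> dual_norm N z"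
proof -
  obtain m where m: "0 < m" "\<And>x. m * norm x \<le> N x"
    using is_norm_ge_norm[OF N] by blast
  have "z \<bullet> x \<le> norm z * (1 / m)" if "N x \<le> 1" for x
  proof -
    have "norm x \<le> 1 / m"
      using m(2)[of x] that m(1) by (simp add: field_simps)
    then show ?thesis
      using norm_cauchy_schwarz[of z x] by (meson mult_left_mono norm_ge_zero order_trans)
  qed
  then have "bdd_above ((\<lambda>x. z \<bullet> x) ` {x. N x \<le> 1})"
    by (intro bdd_aboveI2[where M = "norm z * (1 / m)"]) auto
  then show ?thesis
    unfolding dual_norm_def using \<open>N w \<le> 1\<close> by (intro cSUP_upper) auto
qed

lemma dual_norm_nonneg:
  fixes N :: "'a::euclidean_space \<Rightarrow> real"
  assumes "is_norm N"
  shows "0 \<le> dual_norm N z"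
proof -
  have "N 0 \<le> 1"
    by (simp add: is_norm_zero[OF assms])
  from dual_norm_upper[OF assms this, of z] show ?thesis by simp
qed

lemma inner_le_dual_norm:
  fixes N :: "'a::euclidean_space \<Rightarrow> real"
  assumes N: "is_norm N"
  shows "z \<bullet> w \<le> dual_norm N z * N w"
proof (cases "w = 0")
  case True
  then show ?thesis by (simp add: is_norm_zero[OF N])
next
  case False
  then have pos: "0 < N w"
    by (rule is_norm_pos[OF N])
  then have "N (inverse (N w) *\<^sub>R w) \<le> 1"
    by (simp add: is_norm_scaleR[OF N])
  from dual_norm_upper[OF N this, of z] show ?thesis
    using pos by (simp add: field_simps)
qed

text \<open>
  A domain with two points forces the Lipschitz constant to be nonnegative. For the cone
  these points are the optimum \<open>xs\<close> and the apex \<open>0\<close>.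
\<close>

lemma lipschitz_gradient_nonneg:
  fixes N :: "'a::euclidean_space \<Rightarrow> real"
  assumes N: "is_norm N" and "lipschitz_gradient N L G K" and "a \<in> K" "b \<in> K" "a \<noteq> b"
  shows "0 \<le> L"
proof -
  have "0 \<le> dual_norm N (G a - G b)"
    by (rule dual_norm_nonneg[OF N])
  also have "\<dots> \<le> L * N (a - b)"
    using assms by (auto simp: lipschitz_gradient_def)
  finally have "0 \<le> L * N (a - b)" .
  moreover have "0 < N (a - b)"
    using \<open>a \<noteq> b\<close> by (intro is_norm_pos[OF N]) simp
  ultimately show ?thesis
    by (simp add: zero_le_mult_iff)
qed

section \<open>Functions with Lipschitz gradient\<close>

text \<open>
  The set \<open>T\<close> of admissible parameters is left free because two kinds are needed: a compact
  segment for the descent lemma and an open ray for optimality of the scaling.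
\<close>

lemma has_gradient_on_line:
  assumes grad: "has_gradient_on f G K"
    and sub: "\<And>t. t \<in> T \<Longrightarrow> a + t *\<^sub>R d \<in> K"
    and t: "t \<in> T"
  shows "((\<lambda>t. f (a + t *\<^sub>R d)) has_real_derivative G (a + t *\<^sub>R d) \<bullet> d) (at t within T)"
proof -
  have "(f has_derivative (\<lambda>h. G (a + t *\<^sub>R d) \<bullet> h)) (at (a + t *\<^sub>R d) within K)"
    using grad sub[OF t] by (auto simp: has_gradient_on_def)
  then have "(f has_derivative (\<lambda>h. G (a + t *\<^sub>R d) \<bullet> h))
      (at (a + t *\<^sub>R d) within (\<lambda>t. a + t *\<^sub>R d) ` T)"
    by (rule has_derivative_subset) (use sub in auto)
  moreover have "((\<lambda>t. a + t *\<^sub>R d) has_derivative (\<lambda>s. s *\<^sub>R d)) (at t within T)"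
    by (auto intro!: derivative_eq_intros)
  ultimately have "((\<lambda>t. f (a + t *\<^sub>R d)) has_derivative (\<lambda>s. G (a + t *\<^sub>R d) \<bullet> (s *\<^sub>R d)))
      (at t within T)"
    by (rule has_derivative_in_compose[rotated])
  then show ?thesis
    by (simp add: has_field_derivative_def mult_commute_abs)
qed

text \<open>
  Along the segment from \<open>a\<close> to \<open>b\<close>, the Lipschitz bound caps the growth of the slope by
  \<open>L t (N d)\<^sup>2\<close>; so \<open>f\<close> minus its tangent and minus the quadratic with that slope is nonincreasing.
\<close>

lemma descent_lemma:
  fixes N :: "'a::euclidean_space \<Rightarrow> real"
  assumes N: "is_norm N" and "convex K"
    and grad: "has_gradient_on f G K" and lip: "lipschitz_gradient N L G K"
    and a: "a \<in> K" and b: "b \<in> K"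
  shows "f b \<le> f a + G a \<bullet> (b - a) + L / 2 * (N (b - a))\<^sup>2"
proof -
  define d where "d = b - a"
  define \<phi> where "\<phi> = (\<lambda>t. f (a + t *\<^sub>R d) - t * (G a \<bullet> d) - L / 2 * t\<^sup>2 * (N d)\<^sup>2)"
  have seg: "a + t *\<^sub>R d \<in> K" if "t \<in> {0..1}" for t
  proof -
    have "(1 - t) *\<^sub>R a + t *\<^sub>R b \<in> K"
      using that a b \<open>convex K\<close> by (simp add: convexD)
    then show ?thesis by (simp add: d_def algebra_simps)
  qed
  have deriv: "(\<phi> has_real_derivative (G (a + t *\<^sub>R d) - G a) \<bullet> d - L * t * (N d)\<^sup>2)
      (at t within {0..1})" if "t \<in> {0..1}" for t
    unfolding \<phi>_def inner_diff_left
    by (rule derivative_eq_intros has_gradient_on_line[OF grad seg that] refl | simp)+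
  have nonpos: "(G (a + t *\<^sub>R d) - G a) \<bullet> d - L * t * (N d)\<^sup>2 \<le> 0" if "t \<in> {0..1}" for t
  proof -
    have "(G (a + t *\<^sub>R d) - G a) \<bullet> d \<le> dual_norm N (G (a + t *\<^sub>R d) - G a) * N d"
      by (rule inner_le_dual_norm[OF N])
    also have "\<dots> \<le> (L * N (a + t *\<^sub>R d - a)) * N d"
      using lip seg[OF that] a is_norm_nonneg[OF N]
      by (intro mult_right_mono) (simp_all only: lipschitz_gradient_def)
    also have "\<dots> = L * t * (N d)\<^sup>2"
      using that by (simp add: is_norm_scaleR[OF N] power2_eq_square)
    finally show ?thesis by simp
  qed
  have "\<phi> 1 \<le> \<phi> 0"
  proof (rule DERIV_nonpos_imp_decreasing_open[where f = \<phi> and a = 0 and b = 1])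
    show "\<exists>y. (\<phi> has_real_derivative y) (at t) \<and> y \<le> 0" if "0 < t" "t < 1" for t
      using deriv[of t] nonpos[of t] that by (force simp: at_within_Icc_at)
    show "continuous_on {0..1} \<phi>"
      by (rule DERIV_continuous_on) (rule deriv)
  qed simp
  then show ?thesis by (simp add: \<phi>_def d_def)
qed

text \<open>
  If \<open>\<eta> > 0\<close>, then \<open>\<eta>\<close> is an interior minimum of \<open>e \<mapsto> f (e p)\<close>, whose derivative must vanish; if
  \<open>\<eta> = 0\<close>, the point itself is zero.
\<close>

lemma gradient_orthogonal_at_ray_minimizer:
  assumes "convex_cone K" and grad: "has_gradient_on f G K" and p: "p \<in> K"
    and min: "is_arg_min (\<lambda>e. f (e *\<^sub>R p)) (\<lambda>e. 0 \<le> e) \<eta>"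
  shows "G (\<eta> *\<^sub>R p) \<bullet> (\<eta> *\<^sub>R p) = 0"
proof (cases "\<eta> = 0")
  case False
  then have \<eta>: "0 < \<eta>"
    using min by (auto simp: is_arg_min_linorder)
  have "((\<lambda>e. f (0 + e *\<^sub>R p)) has_real_derivative G (0 + \<eta> *\<^sub>R p) \<bullet> p) (at \<eta> within {0<..})"
    using \<eta> p \<open>convex_cone K\<close>
    by (intro has_gradient_on_line[OF grad]) (auto simp: convex_cone_scaleR)
  then have "((\<lambda>e. f (e *\<^sub>R p)) has_real_derivative G (\<eta> *\<^sub>R p) \<bullet> p) (at \<eta>)"
    using \<eta> by (simp add: at_within_open[where S = "{0<..}"])
  \<comment> \<open>Points within distance \<open>\<eta>\<close> of \<open>\<eta>\<close> are nonnegative, so the constrained minimum is a local one.\<close>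
  then have "G (\<eta> *\<^sub>R p) \<bullet> p = 0"
    by (rule DERIV_local_min[OF _ \<eta>]) (use min in \<open>auto simp: is_arg_min_linorder\<close>)
  then show ?thesis by simp
qed simp

section \<open>Momentum conic descent\<close>

lemma
  assumes "moco N K f G \<delta> g0 x \<eta> g v \<theta>"
  shows moco_start: "x 0 \<in> K"
    and moco_scale: "is_arg_min (\<lambda>e. f (e *\<^sub>R x k)) (\<lambda>e. 0 \<le> e) (\<eta> k)"
    and moco_momentum: "g k = (1 - \<delta> k) *\<^sub>R (case k of 0 \<Rightarrow> g0 | Suc j \<Rightarrow> g j) + \<delta> k *\<^sub>R G (\<eta> k *\<^sub>R x k)"
    and moco_direction: "is_arg_min (\<lambda>w. g k \<bullet> w) (\<lambda>w. w \<in> K \<and> N w \<le> 1) (v k)"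
    and moco_step: "is_arg_min (\<lambda>t. f (\<eta> k *\<^sub>R x k + t *\<^sub>R v k)) (\<lambda>t. 0 \<le> t) (\<theta> k)"
    and moco_next: "x (Suc k) = \<eta> k *\<^sub>R x k + \<theta> k *\<^sub>R v k"
  using assms unfolding moco_def by blast+

lemma moco_iterate_mem:
  assumes "convex_cone K" and moco: "moco N K f G \<delta> g0 x \<eta> g v \<theta>"
  shows "x k \<in> K"
proof (induction k)
  case 0
  show ?case by (rule moco_start[OF moco])
next
  case (Suc k)
  have "\<eta> k *\<^sub>R x k \<in> K" "\<theta> k *\<^sub>R v k \<in> K"
    using Suc moco_scale[OF moco, of k] moco_step[OF moco, of k] moco_direction[OF moco, of k]
      \<open>convex_cone K\<close> by (auto simp: is_arg_min_linorder convex_cone_scaleR)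
  then show ?case
    using \<open>convex_cone K\<close> by (simp add: moco_next[OF moco] convex_cone_add)
qed

lemma moco_scaled_iterate_mem:
  assumes "convex_cone K" and moco: "moco N K f G \<delta> g0 x \<eta> g v \<theta>"
  shows "\<eta> k *\<^sub>R x k \<in> K"
  using moco_iterate_mem[OF assms, of k] moco_scale[OF moco, of k] \<open>convex_cone K\<close>
  by (auto simp: is_arg_min_linorder convex_cone_scaleR)

text \<open>
  Both line searches can only improve on a fixed choice: scaling \<open>1\<close> at the new point and an
  arbitrary step \<open>t\<close> from the old one. The descent lemma bounds the effect of that choice, and
  \<open>N (v k) \<le> 1\<close> makes the error independent of the size of the iterates.
\<close>

lemma moco_progress:
  fixes N :: "'a::euclidean_space \<Rightarrow> real"
  assumes N: "is_norm N" and cone: "convex_cone K"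
    and grad: "has_gradient_on f G K" and lip: "lipschitz_gradient N L G K" and "0 \<le> L"
    and moco: "moco N K f G \<delta> g0 x \<eta> g v \<theta>" and "0 \<le> t"
  shows "f (\<eta> (Suc k) *\<^sub>R x (Suc k))
    \<le> f (\<eta> k *\<^sub>R x k) + t * (G (\<eta> k *\<^sub>R x k) \<bullet> v k) + L / 2 * t\<^sup>2"
proof -
  define y where "y = \<eta> k *\<^sub>R x k"
  have y: "y \<in> K"
    unfolding y_def by (rule moco_scaled_iterate_mem[OF cone moco])
  have v: "v k \<in> K" "N (v k) \<le> 1"
    using moco_direction[OF moco, of k] by (auto simp: is_arg_min_linorder)
  have yv: "y + t *\<^sub>R v k \<in> K"
    using y v \<open>0 \<le> t\<close> cone by (simp add: convex_cone_add convex_cone_scaleR)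
  have "f (\<eta> (Suc k) *\<^sub>R x (Suc k)) \<le> f (1 *\<^sub>R x (Suc k))"
    using moco_scale[OF moco, of "Suc k"] by (auto simp only: is_arg_min_linorder zero_le_one)
  also have "\<dots> = f (y + \<theta> k *\<^sub>R v k)"
    by (simp add: moco_next[OF moco] y_def)
  also have "\<dots> \<le> f (y + t *\<^sub>R v k)"
    using moco_step[OF moco, of k] \<open>0 \<le> t\<close> by (auto simp: is_arg_min_linorder y_def)
  also have "\<dots> \<le> f y + t * (G y \<bullet> v k) + L / 2 * (N (t *\<^sub>R v k))\<^sup>2"
    using descent_lemma[OF N _ grad lip y yv] cone by (simp add: convex_cone_def)
  also have "N (t *\<^sub>R v k) = t * N (v k)"
    using \<open>0 \<le> t\<close> by (simp add: is_norm_scaleR[OF N])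
  also have "L / 2 * (t * N (v k))\<^sup>2 \<le> L / 2 * t\<^sup>2"
    using v \<open>0 \<le> t\<close> \<open>0 \<le> L\<close> is_norm_nonneg[OF N]
    by (intro mult_left_mono power_mono mult_left_le) auto
  finally show ?thesis by (simp add: y_def)
qed

text \<open>
  The weights \<open>\<delta>\<^sub>k = 2/(k+2)\<close> are those for which the momentum, rescaled by \<open>(k+1)(k+2)\<close>, becomes a
  plain running sum: \<open>(k+1)(k+2)(1 - \<delta>\<^sub>k) = k(k+1)\<close>. The value \<open>\<delta>\<^sub>0 = 1\<close> erases \<open>g0\<close>.
\<close>

lemma moco_momentum_eq_average:
  assumes moco: "moco N K f G (\<lambda>j. 2 / (real j + 2)) g0 x \<eta> g v \<theta>"
  shows "((real k + 1) * (real k + 2)) *\<^sub>R g k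
    = (\<Sum>\<tau>=0..k. (2 * (real \<tau> + 1)) *\<^sub>R G (\<eta> \<tau> *\<^sub>R x \<tau>))"
proof (induction k)
  case 0
  show ?case using moco_momentum[OF moco, of 0] by simp
next
  case (Suc k)
  define c where "c = (real (Suc k) + 1) * (real (Suc k) + 2)"
  have "c * (1 - 2 / (real (Suc k) + 2)) = (real k + 1) * (real k + 2)"
    and "c * (2 / (real (Suc k) + 2)) = 2 * (real (Suc k) + 1)"
    unfolding c_def by (simp_all add: divide_simps) (simp_all add: algebra_simps)
  moreover have "c *\<^sub>R g (Suc k) = (c * (1 - 2 / (real (Suc k) + 2))) *\<^sub>R g k
      + (c * (2 / (real (Suc k) + 2))) *\<^sub>R G (\<eta> (Suc k) *\<^sub>R x (Suc k))"
    using moco_momentum[OF moco, of "Suc k"] by (simp only: scaleR_add_right scaleR_scaleR) simp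
  ultimately show ?case
    using Suc by (simp add: c_def)
qed

text \<open>
  The recursion for \<open>f(y\<^sub>k\<^sub>+\<^sub>1) - \<Phi>\<^sub>k(R v\<^sub>k)\<close>, multiplied by \<open>(k+1)(k+2)\<close>. The new tangent plane enters
  evaluated at \<open>R v\<^sub>k\<^sub>+\<^sub>1\<close>, which is what the progress bound provides, while the average of
  the old planes can only get larger when \<open>v\<^sub>k\<close> is replaced by \<open>v\<^sub>k\<^sub>+\<^sub>1\<close>, by minimality of \<open>v\<^sub>k\<close>. The radius \<open>R\<close> is
  arbitrary here: the algorithm does not know the norm of the solution.
\<close>

lemma moco_estimate:
  fixes N :: "'a::euclidean_space \<Rightarrow> real"
  assumes N: "is_norm N" and cone: "convex_cone K"
    and grad: "has_gradient_on f G K" and lip: "lipschitz_gradient N L G K" and L: "0 \<le> L"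
    and moco: "moco N K f G (\<lambda>j. 2 / (real j + 2)) g0 x \<eta> g v \<theta>" and R: "0 \<le> R"
  shows "(real k + 1) * (real k + 2) * f (\<eta> (Suc k) *\<^sub>R x (Suc k))
    \<le> (\<Sum>\<tau>=0..k. 2 * (real \<tau> + 1) * f (\<eta> \<tau> *\<^sub>R x \<tau>))
      + R * (((real k + 1) * (real k + 2)) *\<^sub>R g k \<bullet> v k) + 2 * L * R\<^sup>2 * (real k + 1)"
proof (induction k)
  note progress = moco_progress[OF N cone grad lip L moco]
  define F where "F = (\<lambda>k. f (\<eta> k *\<^sub>R x k))"
  define \<Gamma> where "\<Gamma> = (\<lambda>k. G (\<eta> k *\<^sub>R x k))"
  have step: "(real k + 1) * (real k + 2) * F (Suc k)
      \<le> (real k + 1) * (real k + 2) * F k + R * (2 * (real k + 1) * (\<Gamma> k \<bullet> v k)) + 2 * L * R\<^sup>2" for k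
  proof -
    \<comment> \<open>The step \<open>t = \<delta>\<^sub>k R\<close> gives the new tangent plane exactly its weight in \<open>\<Phi>\<^sub>k\<close>.\<close>
    have "F (Suc k) \<le> F k + 2 * R / (real k + 2) * (\<Gamma> k \<bullet> v k) + L / 2 * (2 * R / (real k + 2))\<^sup>2"
      unfolding F_def \<Gamma>_def by (rule progress) (use R in simp)
    then have "(real k + 1) * (real k + 2) * F (Suc k) \<le> (real k + 1) * (real k + 2) *
        (F k + 2 * R / (real k + 2) * (\<Gamma> k \<bullet> v k) + L / 2 * (2 * R / (real k + 2))\<^sup>2)"
      by (rule mult_left_mono) simp
    also have "\<dots> = (real k + 1) * (real k + 2) * F k + R * (2 * (real k + 1) * (\<Gamma> k \<bullet> v k))
        + 2 * L * R\<^sup>2 * ((real k + 1) / (real k + 2))"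
      by (simp add: divide_simps power2_eq_square) (simp add: algebra_simps)
    also have "2 * L * R\<^sup>2 * ((real k + 1) / (real k + 2)) \<le> 2 * L * R\<^sup>2"
      using L by (intro mult_left_le) auto
    finally show ?thesis by simp
  qed
  {
    case 0
    show ?case
      using step[of 0] moco_momentum_eq_average[OF moco, of 0]
      by (simp add: F_def \<Gamma>_def)
  next
    case (Suc k)
    let ?m = "\<lambda>k. ((real k + 1) * (real k + 2)) *\<^sub>R g k"
    have m: "?m (Suc k) = ?m k + (2 * (real (Suc k) + 1)) *\<^sub>R \<Gamma> (Suc k)"
      unfolding moco_momentum_eq_average[OF moco] \<Gamma>_def by simp
    have "g k \<bullet> v k \<le> g k \<bullet> v (Suc k)"
      using moco_direction[OF moco, of k] moco_direction[OF moco, of "Suc k"]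
      by (auto simp: is_arg_min_linorder)
    then have mv: "R * (?m k \<bullet> v k) \<le> R * (?m k \<bullet> v (Suc k))"
      using R by (auto intro!: mult_left_mono)
    have "(real (Suc k) + 1) * (real (Suc k) + 2) * F (Suc (Suc k))
        \<le> (real (Suc k) + 1) * (real (Suc k) + 2) * F (Suc k)
          + R * (2 * (real (Suc k) + 1) * (\<Gamma> (Suc k) \<bullet> v (Suc k))) + 2 * L * R\<^sup>2"
      by (rule step)
    also have "(real (Suc k) + 1) * (real (Suc k) + 2) * F (Suc k)
        = (real k + 1) * (real k + 2) * F (Suc k) + 2 * (real (Suc k) + 1) * F (Suc k)"
      by (simp add: algebra_simps)
    also have "(real k + 1) * (real k + 2) * F (Suc k)
        \<le> (\<Sum>\<tau>=0..k. 2 * (real \<tau> + 1) * F \<tau>) + R * (?m k \<bullet> v (Suc k)) + 2 * L * R\<^sup>2 * (real k + 1)"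
      using Suc mv by (simp add: F_def)
    finally have "(real (Suc k) + 1) * (real (Suc k) + 2) * F (Suc (Suc k))
        \<le> (\<Sum>\<tau>=0..Suc k. 2 * (real \<tau> + 1) * F \<tau>)
          + R * (?m k \<bullet> v (Suc k) + 2 * (real (Suc k) + 1) * (\<Gamma> (Suc k) \<bullet> v (Suc k)))
          + 2 * L * R\<^sup>2 * (real (Suc k) + 1)"
      by (simp add: algebra_simps)
    then show ?case
      unfolding m F_def by (simp add: inner_add_left)
  }
qed

lemma moco_rho_nonneg:
  assumes "strictly_convex_grad f G K" and "xs \<in> K" and "\<And>\<tau>. \<eta> \<tau> *\<^sub>R x \<tau> \<in> K"
  shows "0 \<le> moco_rho f G x \<eta> xs k"
proof -
  have "0 \<le> bregman_gap f G x \<eta> \<tau> xs" for \<tau>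
    using assms(1,2) assms(3)[of \<tau>]
    by (cases "xs = \<eta> \<tau> *\<^sub>R x \<tau>") (force simp: bregman_gap_def strictly_convex_grad_def)+
  then show ?thesis
    unfolding moco_rho_def by (intro sum_nonneg mult_nonneg_nonneg) auto
qed

text \<open>
  The weighted Bregman gaps measure how far the averaged tangent plane lies below \<open>f\<close> at \<open>z\<close>.
  Orthogonality of \<open>G(y\<^sub>\<tau>)\<close> to \<open>y\<^sub>\<tau>\<close> removes the terms \<open>G(y\<^sub>\<tau>) \<bullet> y\<^sub>\<tau>\<close>, so that only the momentum
  remains as linear part.
\<close>

lemma moco_rho_eq:
  assumes cone: "convex_cone K" and grad: "has_gradient_on f G K"
    and moco: "moco N K f G (\<lambda>j. 2 / (real j + 2)) g0 x \<eta> g v \<theta>"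
  shows "(real k + 1) * (real k + 2) * moco_rho f G x \<eta> z k
    = (real k + 1) * (real k + 2) * f z - (\<Sum>\<tau>=0..k. 2 * (real \<tau> + 1) * f (\<eta> \<tau> *\<^sub>R x \<tau>))
      - ((real k + 1) * (real k + 2)) *\<^sub>R g k \<bullet> z"
proof -
  have gap: "bregman_gap f G x \<eta> \<tau> z = f z - f (\<eta> \<tau> *\<^sub>R x \<tau>) - G (\<eta> \<tau> *\<^sub>R x \<tau>) \<bullet> z" for \<tau>
    using gradient_orthogonal_at_ray_minimizer[OF cone grad moco_iterate_mem[OF cone moco]
        moco_scale[OF moco], of \<tau>]
    by (simp add: bregman_gap_def inner_diff_right)
  have weights: "(\<Sum>\<tau>=0..k. 2 * (real \<tau> + 1)) = (real k + 1) * (real k + 2)"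
    by (induction k) (auto simp: algebra_simps)
  have "(real k + 1) * (real k + 2) * moco_rho f G x \<eta> z k
      = (\<Sum>\<tau>=0..k. 2 * (real \<tau> + 1) * bregman_gap f G x \<eta> \<tau> z)"
    by (simp add: moco_rho_def sum_distrib_left)
  also have "\<dots> = (\<Sum>\<tau>=0..k. 2 * (real \<tau> + 1)) * f z
      - (\<Sum>\<tau>=0..k. 2 * (real \<tau> + 1) * f (\<eta> \<tau> *\<^sub>R x \<tau>))
      - (\<Sum>\<tau>=0..k. (2 * (real \<tau> + 1)) *\<^sub>R G (\<eta> \<tau> *\<^sub>R x \<tau>)) \<bullet> z"
    by (simp only: gap right_diff_distrib sum_subtractf sum_distrib_right inner_sum_left
        inner_scaleR_left)
  finally show ?thesis
    by (simp only: weights moco_momentum_eq_average[OF moco])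
qed

theorem corollary1:
  fixes N :: "real ^ 'd \<Rightarrow> real"
    and K :: "(real ^ 'd) set"
    and f :: "real ^ 'd \<Rightarrow> real"
    and G :: "real ^ 'd \<Rightarrow> real ^ 'd"
    and L :: real
    and xs g0 :: "real ^ 'd"
    and x g v :: "nat \<Rightarrow> real ^ 'd"
    and \<eta> \<theta> :: "nat \<Rightarrow> real"
    and k :: nat
  assumes "is_norm N"
    and "convex_cone K"
    and "has_gradient_on f G K"
    and "strictly_convex_grad f G K"
    and "lipschitz_gradient N L G K"
    and "is_arg_min f (\<lambda>y. y \<in> K) xs"
    and "xs \<noteq> 0"
    and "moco N K f G (\<lambda>j. 2 / (real j + 2)) g0 x \<eta> g v \<theta>"
  shows "0 \<le> moco_rho f G x \<eta> xs k \<and>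
         f (\<eta> (k + 1) *\<^sub>R x (k + 1)) - f xs \<le> 2 * L * (N xs)\<^sup>2 / (real k + 2) - moco_rho f G x \<eta> xs k"
proof
  note N = assms(1) and cone = assms(2) and moco = assms(8)
  have xs: "xs \<in> K"
    using assms(6) by (simp add: is_arg_min_linorder)
  show "0 \<le> moco_rho f G x \<eta> xs k"
    by (rule moco_rho_nonneg[OF assms(4) xs moco_scaled_iterate_mem[OF cone moco]])
  have L: "0 \<le> L"
    by (rule lipschitz_gradient_nonneg[OF N assms(5) xs convex_cone_contains_0[OF cone] \<open>xs \<noteq> 0\<close>])
  define R where "R = N xs"
  have R: "0 < R"
    unfolding R_def by (rule is_norm_pos[OF N \<open>xs \<noteq> 0\<close>])
  define c where "c = (real k + 1) * (real k + 2)"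
  have c: "0 < c"
    by (simp add: c_def)
  define S where "S = (\<Sum>\<tau>=0..k. 2 * (real \<tau> + 1) * f (\<eta> \<tau> *\<^sub>R x \<tau>))"
  \<comment> \<open>The optimum scaled to the unit sphere of \<open>N\<close> competes with \<open>v k\<close> as a direction.\<close>
  have "inverse R *\<^sub>R xs \<in> K" "N (inverse R *\<^sub>R xs) \<le> 1"
    using cone xs R by (auto simp: convex_cone_scaleR is_norm_scaleR[OF N] R_def)
  then have "g k \<bullet> v k \<le> g k \<bullet> (inverse R *\<^sub>R xs)"
    using moco_direction[OF moco, of k] by (auto simp: is_arg_min_linorder)
  then have "R * (g k \<bullet> v k) \<le> g k \<bullet> xs"
    using R by (simp add: field_simps)
  then have gv: "R * (c *\<^sub>R g k \<bullet> v k) \<le> c *\<^sub>R g k \<bullet> xs"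
    using c by (simp add: mult.left_commute)
  have "c * f (\<eta> (k + 1) *\<^sub>R x (k + 1)) \<le> S + R * (c *\<^sub>R g k \<bullet> v k) + 2 * L * R\<^sup>2 * (real k + 1)"
    using moco_estimate[OF N cone assms(3,5) L moco less_imp_le[OF R], of k]
    by (simp add: S_def c_def)
  also have "\<dots> \<le> S + c *\<^sub>R g k \<bullet> xs + 2 * L * R\<^sup>2 * (real k + 1)"
    using gv by simp
  also have "\<dots> = c * f xs - c * moco_rho f G x \<eta> xs k + c * (2 * L * R\<^sup>2 / (real k + 2))"
    using moco_rho_eq[OF cone assms(3) moco, of k xs, folded c_def S_def]
    by (simp add: c_def)
  finally have "c * f (\<eta> (k + 1) *\<^sub>R x (k + 1))
      \<le> c * (f xs - moco_rho f G x \<eta> xs k + 2 * L * R\<^sup>2 / (real k + 2))"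
    by (simp add: algebra_simps)
  then show "f (\<eta> (k + 1) *\<^sub>R x (k + 1)) - f xs
      \<le> 2 * L * (N xs)\<^sup>2 / (real k + 2) - moco_rho f G x \<eta> xs k"
    using c by (simp add: R_def)
qed

end
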